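(* There is a universal constant $C>0$ such that the following holds. Let $f\colon\mathbb{R}^d\to\mathbb{R}$ be convex with a global minimizer $x^*$, $\|x^*\|\le\mathcal{R}$, $\mathcal{R}>0$, $f^*=f(x^* )$, and suppose that $f$ is $(\mathcal{M}_0,\mathcal{M}_1)$-Lipschitz with $\mathcal{M}_0,\mathcal{M}_1\ge0$. Let $\epsilon>0$ and let the number of iterations $K\in\mathbb{N}$ and the stepsizes $\eta_k>0$ be given by $$\frac{1}{\eta_k}=\max\Big\{2\mathcal{M}_1^2\mathcal{F},\ \frac{\mathcal{M}_0\sqrt{K+1}}{\mathcal{R}}\Big\},\qquad K=\Big\lceil[\mathcal{R}\mathcal{M}_1]^2\cdot\frac{\mathcal{F}}{\epsilon}+\Big[\frac{\mathcal{R}\mathcal{M}_0}{\epsilon}\Big]^2\Big\rceil .$$ Let $x_0=0$ and $x_{k+1}=\mathrm{proj}_{Q_{\mathcal{R}}}\big(x_k-\eta_k\nabla f(x_k)\big)$, where $\nabla f(x_k)\in\partial f(x_k)$ is an arbitrary subgradient. Then $\overline{x}_K=\frac{1}{K+1}\sum_{k=0}^K x_k$ satisfies $$f(\overline{x}_K)-f^*\le C\epsilon .$$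
   Context: $\|\cdot\|$ is the Euclidean norm; $Q_{\mathcal{R}}=\{x\in\mathbb{R}^d:\|x\|\le\mathcal{R}\}$; $\mathrm{proj}_{Q_{\mathcal R}}$ is the Euclidean projection onto $Q_{\mathcal R}$; $\mathcal{F}=\max_{x\in Q_{\mathcal{R}}}[f(x)-f^*]$; $\mathbb{N}$ is the set of positive integers. $f$ is $(\mathcal{M}_0,\mathcal{M}_1)$-Lipschitz if $\limsup_{u\to0}\frac{1}{\|u\|}|f(x+u)-f(x)|\le\mathcal{M}_0+\mathcal{M}_1[f(x)-f^*]$ for all $x\in\mathbb{R}^d$ (for convex $f$, equivalently: $\|g\|\le\mathcal{M}_0+\mathcal{M}_1[f(x)-f^*]$ for all $x$ and all $g\in\partial f(x)$). *)

theory Defs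
  imports "HOL-Analysis.Analysis"
begin

text \<open>
  The constant in the main statement must not depend on the dimension. With \<open>real ^ 'n\<close> or a
  \<open>euclidean_space\<close> type the dimension is part of the type, and a type cannot be quantified inside
  the scope of \<open>\<exists>C\<close>. Therefore all spaces \<open>\<real>\<^sup>d\<close> are realised as the subspaces \<open>Rd d\<close> of one
  inner product space: the finitely supported real sequences with the Euclidean inner product.
  This is the same carrier as that of \<open>Euclidean_space d\<close> in the library, but with the vector space
  and metric structure as class instances. (The library norm on \<open>nat \<Rightarrow>\<^sub>0 real\<close> is the
  \<open>\<ell>\<^sub>1\<close> norm, so that type cannot be used.)
\<close>

typedef fseq = "{x :: nat \<Rightarrow> real. finite {i. x i \<noteq> 0}}"
  morphisms coord Abs_fseq
  by (rule exI[of _ "\<lambda>_. 0"]) simp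

setup_lifting type_definition_fseq

lemma fseq_eqI: "(\<And>i. coord x i = coord y i) \<Longrightarrow> x = y"
  by transfer auto

lemma finite_coord [simp]: "finite {i. coord x i \<noteq> 0}"
  using coord[of x] by simp

instantiation fseq :: real_vector
begin

lift_definition zero_fseq :: fseq is "\<lambda>_. 0" by simp

lift_definition plus_fseq :: "fseq \<Rightarrow> fseq \<Rightarrow> fseq" is "\<lambda>x y i. x i + y i"
proof -
  fix x y :: "nat \<Rightarrow> real"
  assume "finite {i. x i \<noteq> 0}" "finite {i. y i \<noteq> 0}"
  then have "finite ({i. x i \<noteq> 0} \<union> {i. y i \<noteq> 0})" by simp
  then show "finite {i. x i + y i \<noteq> 0}" by (rule rev_finite_subset) auto
qed

lift_definition uminus_fseq :: "fseq \<Rightarrow> fseq" is "\<lambda>x i. - x i" by simp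

lift_definition minus_fseq :: "fseq \<Rightarrow> fseq \<Rightarrow> fseq" is "\<lambda>x y i. x i - y i"
proof -
  fix x y :: "nat \<Rightarrow> real"
  assume "finite {i. x i \<noteq> 0}" "finite {i. y i \<noteq> 0}"
  then have "finite ({i. x i \<noteq> 0} \<union> {i. y i \<noteq> 0})" by simp
  then show "finite {i. x i - y i \<noteq> 0}" by (rule rev_finite_subset) auto
qed

lift_definition scaleR_fseq :: "real \<Rightarrow> fseq \<Rightarrow> fseq" is "\<lambda>c x i. c * x i"
  by (auto elim: rev_finite_subset)

instance
  by standard (transfer, simp add: fun_eq_iff algebra_simps)+

end

lemma coord_simps [simp]:
  "coord 0 i = 0"
  "coord (x + y) i = coord x i + coord y i"
  "coord (- x) i = - coord x i"
  "coord (x - y) i = coord x i - coord y i"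
  "coord (c *\<^sub>R x) i = c * coord x i"
  by (transfer, simp)+

instantiation fseq :: real_inner
begin

text \<open>Summing over the support of \<open>x\<close> alone is enough, since the other products vanish.\<close>

definition inner_fseq :: "fseq \<Rightarrow> fseq \<Rightarrow> real"
  where "inner_fseq x y = (\<Sum>i | coord x i \<noteq> 0. coord x i * coord y i)"

definition norm_fseq :: "fseq \<Rightarrow> real"
  where "norm_fseq x = sqrt (inner x x)"

definition dist_fseq :: "fseq \<Rightarrow> fseq \<Rightarrow> real"
  where "dist_fseq x y = norm (x - y)"

definition sgn_fseq :: "fseq \<Rightarrow> fseq"
  where "sgn_fseq x = inverse (norm x) *\<^sub>R x"

definition uniformity_fseq :: "(fseq \<times> fseq) filter"
  where "uniformity_fseq = (INF e\<in>{0 <..}. principal {(x, y). dist x y < e})"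

definition open_fseq :: "fseq set \<Rightarrow> bool"
  where "open_fseq U \<longleftrightarrow> (\<forall>x\<in>U. eventually (\<lambda>(x', y). x' = x \<longrightarrow> y \<in> U) uniformity)"

lemma inner_fseq_eq_sum:
  assumes "finite A" "{i. coord x i \<noteq> 0} \<subseteq> A"
  shows "inner x y = (\<Sum>i\<in>A. coord x i * coord y i)"
  unfolding inner_fseq_def using assms by (intro sum.mono_neutral_left) auto

instance
proof
  fix x y z :: fseq and r :: real
  let ?A = "{i. coord x i \<noteq> 0} \<union> {i. coord y i \<noteq> 0}"
  have fin: "finite ?A" by simp
  show "dist x y = norm (x - y)" by (rule dist_fseq_def)
  show "sgn x = x /\<^sub>R norm x" by (rule sgn_fseq_def)
  show "(uniformity :: (fseq \<times> fseq) filter) = (INF e\<in>{0 <..}. principal {(x, y). dist x y < e})"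
    by (rule uniformity_fseq_def)
  show "open U \<longleftrightarrow> (\<forall>x\<in>U. \<forall>\<^sub>F (x', y) in uniformity. x' = x \<longrightarrow> y \<in> U)" for U :: "fseq set"
    by (rule open_fseq_def)
  show "inner x y = inner y x"
    by (simp add: inner_fseq_eq_sum[OF fin] mult.commute)
  have "inner (x + y) z = (\<Sum>i\<in>?A. coord (x + y) i * coord z i)"
    by (rule inner_fseq_eq_sum[OF fin]) auto
  then show "inner (x + y) z = inner x z + inner y z"
    by (simp add: inner_fseq_eq_sum[OF fin] distrib_right sum.distrib)
  have "inner (r *\<^sub>R x) y = (\<Sum>i\<in>?A. coord (r *\<^sub>R x) i * coord y i)"
    by (rule inner_fseq_eq_sum[OF fin]) auto
  then show "inner (r *\<^sub>R x) y = r * inner x y"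
    by (simp add: inner_fseq_eq_sum[OF fin] sum_distrib_left mult.assoc)
  show "0 \<le> inner x x" by (simp add: inner_fseq_def sum_nonneg)
  have "inner x x = 0 \<longleftrightarrow> (\<forall>i\<in>{i. coord x i \<noteq> 0}. coord x i * coord x i = 0)"
    unfolding inner_fseq_def by (rule sum_nonneg_eq_0_iff) auto
  also have "\<dots> \<longleftrightarrow> x = 0" by (auto intro: fseq_eqI)
  finally show "inner x x = 0 \<longleftrightarrow> x = 0" .
  show "norm x = sqrt (inner x x)" by (rule norm_fseq_def)
qed

end

definition Rd :: "nat \<Rightarrow> fseq set"
  where "Rd d = {x. \<forall>i\<ge>d. coord x i = 0}"

lemma coord_Rd_eq: "coord ` Rd d = topspace (Euclidean_space d)"
proof -
  have "x \<in> coord ` Rd d" if "\<forall>i\<ge>d. x i = 0" for x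
  proof -
    have "{i. x i \<noteq> 0} \<subseteq> {..<d}" using that by (auto simp: not_le[symmetric])
    then have "finite {i. x i \<noteq> 0}" by (rule finite_subset) simp
    then have "coord (Abs_fseq x) = x" by (simp add: Abs_fseq_inverse)
    with that show ?thesis unfolding Rd_def by (intro image_eqI[of _ _ "Abs_fseq x"]) auto
  qed
  then show ?thesis by (auto simp: Rd_def topspace_Euclidean_space)
qed

lemma inner_Rd:
  assumes "x \<in> Rd d"
  shows "inner x y = (\<Sum>i<d. coord x i * coord y i)"
  using assms by (intro inner_fseq_eq_sum) (auto simp: Rd_def not_le[symmetric])

lemma norm_Rd:
  assumes "x \<in> Rd d"
  shows "norm x = L2_set (coord x) {..<d}"
  using inner_Rd[OF assms, of x] by (simp add: norm_fseq_def L2_set_def power2_eq_square)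

text \<open>
  Functions on \<open>\<real>\<^sup>d\<close> are represented by functions on \<open>fseq\<close>. Only their values on \<open>Rd d\<close> are
  ever used; in particular \<open>u\<close> below tends to \<open>0\<close> inside \<open>Rd d\<close>, and subgradients lie in \<open>Rd d\<close>.
  The upper limit is taken in \<open>ereal\<close>, so that it may be infinite.
\<close>

definition gen_Lipschitz :: "nat \<Rightarrow> (fseq \<Rightarrow> real) \<Rightarrow> real \<Rightarrow> real \<Rightarrow> real \<Rightarrow> bool"
  where "gen_Lipschitz d f fstar M0 M1 \<longleftrightarrow>
    (\<forall>x\<in>Rd d. Limsup (at 0 within Rd d) (\<lambda>u. ereal (1 / norm u * \<bar>f (x + u) - f x\<bar>))
                 \<le> ereal (M0 + M1 * (f x - fstar)))"

definition subdifferential :: "nat \<Rightarrow> (fseq \<Rightarrow> real) \<Rightarrow> fseq \<Rightarrow> fseq set"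
  where "subdifferential d f x = {g \<in> Rd d. \<forall>y\<in>Rd d. f x + inner g (y - x) \<le> f y}"

definition Q :: "nat \<Rightarrow> real \<Rightarrow> fseq set"
  where "Q d R = {x \<in> Rd d. norm x \<le> R}"

text \<open>The library's \<open>closest_point\<close> is restricted to \<open>heine_borel\<close> types, which excludes \<open>fseq\<close>.\<close>

definition proj :: "fseq set \<Rightarrow> fseq \<Rightarrow> fseq"
  where "proj S a = arg_min_on (dist a) S"

text \<open>\<open>Max\<close> is only meaningful for finite sets, hence \<open>GREATEST\<close>.\<close>

definition max_gap :: "nat \<Rightarrow> (fseq \<Rightarrow> real) \<Rightarrow> real \<Rightarrow> real \<Rightarrow> real"
  where "max_gap d f fstar R = (GREATEST v. v \<in> (\<lambda>x. f x - fstar) ` Q d R)"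

end

theory Submission
  imports Defs
begin

text \<open>
  Write \<open>\<delta>\<^sub>k = f x\<^sub>k - f\<^sup>*\<close>. Comparing squared distances to \<open>x\<^sup>*\<close> before and after a step gives
  \<open>2 \<eta> \<delta>\<^sub>k \<le> \<parallel>x\<^sub>k - x\<^sup>*\<parallel>\<^sup>2 - \<parallel>x\<^sub>k\<^sub>+\<^sub>1 - x\<^sup>*\<parallel>\<^sup>2 + \<eta>\<^sup>2 \<parallel>g\<^sub>k\<parallel>\<^sup>2\<close>, where
  \<open>\<parallel>g\<^sub>k\<parallel>\<^sup>2 \<le> 2 M\<^sub>0\<^sup>2 + 2 M\<^sub>1\<^sup>2 \<delta>\<^sub>k\<^sup>2 \<le> 2 M\<^sub>0\<^sup>2 + 2 M\<^sub>1\<^sup>2 F \<delta>\<^sub>k\<close>, since every iterate lies in the ball.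
  As \<open>2 M\<^sub>1\<^sup>2 F \<eta> \<le> 1\<close>, the last term is absorbed by half of the left-hand side. Summing up and
  using convexity, the error is at most \<open>R\<^sup>2 / (\<eta> (K + 1)) + 2 \<eta> M\<^sub>0\<^sup>2 \<le> 3 \<epsilon> + 2 \<epsilon>\<close>.
\<close>

section \<open>Geometry of the finite-dimensional subspaces\<close>

lemma subspace_Rd: "subspace (Rd d)"
  by (auto simp: subspace_def Rd_def)

lemma Q_subset_Rd: "Q d R \<subseteq> Rd d"
  by (auto simp: Q_def)

lemma convex_Q: "convex (Q d R)"
proof -
  have "Q d R = Rd d \<inter> cball 0 R" by (auto simp: Q_def)
  then show ?thesis by (simp add: convex_Int subspace_imp_convex subspace_Rd)
qed

lift_definition unit_fseq :: "nat \<Rightarrow> fseq" is "\<lambda>n i. if i = n then 1 else 0"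
  by simp

lemma coord_unit_fseq [simp]: "coord (unit_fseq n) i = (if i = n then 1 else 0)"
  by transfer simp

lemma abs_coord_le_norm:
  assumes "x \<in> Rd d"
  shows "\<bar>coord x i\<bar> \<le> norm x"
proof (cases "i < d")
  case True
  then have "\<bar>coord x i\<bar> \<le> L2_set (\<lambda>j. \<bar>coord x j\<bar>) {..<d}"
    by (intro member_le_L2_set) auto
  then show ?thesis by (simp add: norm_Rd[OF assms] L2_set_def)
next
  case False
  with assms show ?thesis by (simp add: Rd_def)
qed

text \<open>Closed bounded subsets of \<open>fseq\<close> need not be compact, hence the induction
  on the dimension: a new coordinate turns the box into a continuous image of an interval times the
  previous box.\<close>

lemma compact_box_Rd: "compact {x \<in> Rd d. \<forall>i. \<bar>coord x i\<bar> \<le> R}"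
proof (induction d)
  case 0
  have "{x \<in> Rd 0. \<forall>i. \<bar>coord x i\<bar> \<le> R} \<subseteq> {0}"
    by (auto simp: Rd_def intro: fseq_eqI)
  then show ?case by (meson finite.emptyI finite.insertI finite_imp_compact finite_subset)
next
  case (Suc d)
  let ?B = "\<lambda>d. {x \<in> Rd d. \<forall>i. \<bar>coord x i\<bar> \<le> R}"
  let ?h = "\<lambda>(s, y). y + s *\<^sub>R unit_fseq d"
  have "x \<in> ?h ` ({-R..R} \<times> ?B d)" if x: "x \<in> ?B (Suc d)" for x
  proof (rule image_eqI)
    let ?y = "x - coord x d *\<^sub>R unit_fseq d"
    show "x = ?h (coord x d, ?y)" by simp
    \<comment> \<open>Coordinate \<open>d\<close> of \<open>?y\<close> is 0, and this value must
      obey the bound too.\<close>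
    have "0 \<le> R" using x by (auto intro: order_trans[OF abs_ge_zero])
    with x show "(coord x d, ?y) \<in> {-R..R} \<times> ?B d"
      by (auto simp: Rd_def abs_le_iff minus_le_iff le_Suc_eq)
  qed
  moreover have "?h p \<in> ?B (Suc d)" if "p \<in> {-R..R} \<times> ?B d" for p
    using that by (auto simp: Rd_def)
  ultimately have "?B (Suc d) = ?h ` ({-R..R} \<times> ?B d)" by blast
  moreover have "continuous_on ({-R..R} \<times> ?B d) ?h"
    unfolding case_prod_beta by (intro continuous_intros)
  ultimately show ?case
    using compact_continuous_image[OF _ compact_Times[OF compact_Icc Suc.IH]] by simp
qed

lemma compact_Q: "compact (Q d R)"
proof -
  have "Q d R = {x \<in> Rd d. \<forall>i. \<bar>coord x i\<bar> \<le> R} \<inter> cball 0 R"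
    by (auto simp: Q_def intro: order_trans[OF abs_coord_le_norm])
  then show ?thesis by (simp add: compact_Int_closed compact_box_Rd)
qed

text \<open>\<open>arg_min_on\<close> picks some minimizer, so it says something only once one
  exists; compactness and nonemptiness provide it.\<close>

lemma
  assumes "compact S" "S \<noteq> {}"
  shows proj_in: "proj S a \<in> S"
    and dist_proj_le: "y \<in> S \<Longrightarrow> dist a (proj S a) \<le> dist a y"
proof -
  have "continuous_on S (dist a)" by (intro continuous_intros)
  then obtain p where "is_arg_min (dist a) (\<lambda>x. x \<in> S) p"
    using continuous_attains_inf[OF assms, of "dist a"] by (auto simp: is_arg_min_linorder)
  then have "is_arg_min (dist a) (\<lambda>x. x \<in> S) (proj S a)"
    unfolding proj_def arg_min_on_def arg_min_def by (rule someI)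
  then show "proj S a \<in> S" "y \<in> S \<Longrightarrow> dist a (proj S a) \<le> dist a y"
    by (auto simp: is_arg_min_linorder)
qed

text \<open>By convexity, the vectors from \<open>proj S a\<close> to \<open>a\<close> and to
  \<open>z\<close> have nonpositive inner product, so the law of cosines gives the bound.\<close>

lemma norm_proj_diff_le:
  assumes "compact S" "convex S" "z \<in> S"
  shows "norm (proj S a - z) \<le> norm (a - z)"
proof -
  let ?p = "proj S a"
  have "S \<noteq> {}" using assms(3) by auto
  then have "inner (a - ?p) (z - ?p) \<le> 0"
    using assms by (intro any_closest_point_dot[of S])
      (auto simp: compact_imp_closed proj_in dist_proj_le)
  moreover have "(norm (a - z))\<^sup>2
      = (norm (a - ?p))\<^sup>2 + (norm (?p - z))\<^sup>2 - 2 * inner (a - ?p) (z - ?p)"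
    unfolding power2_norm_eq_inner by (simp add: algebra_simps inner_commute)
  ultimately have "(norm (?p - z))\<^sup>2 \<le> (norm (a - z))\<^sup>2"
    using zero_le_power2[of "norm (a - ?p)"] by linarith
  then show ?thesis by (simp add: power2_le_iff_abs_le)
qed

section \<open>Generalized Lipschitz functions\<close>

lemma gen_Lipschitz_eventually:
  assumes "gen_Lipschitz d f fstar M0 M1" "x \<in> Rd d" "c > M0 + M1 * (f x - fstar)"
  obtains r where "r > 0"
    "\<And>u. u \<in> Rd d \<Longrightarrow> u \<noteq> 0 \<Longrightarrow> norm u < r \<Longrightarrow> \<bar>f (x + u) - f x\<bar> < c * norm u"
proof -
  have "Limsup (at 0 within Rd d) (\<lambda>u. ereal (1 / norm u * \<bar>f (x + u) - f x\<bar>)) < ereal c"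
    using assms unfolding gen_Lipschitz_def by (auto intro: le_less_trans)
  from Limsup_lessD[OF this] obtain r where "r > 0"
    and r: "\<And>u. u \<in> Rd d \<Longrightarrow> u \<noteq> 0 \<Longrightarrow> norm u < r \<Longrightarrow> 1 / norm u * \<bar>f (x + u) - f x\<bar> < c"
    by (auto simp: eventually_at)
  from r have "\<bar>f (x + u) - f x\<bar> < c * norm u" if "u \<in> Rd d" "u \<noteq> 0" "norm u < r" for u
    using that by (simp add: field_simps)
  with \<open>r > 0\<close> show ?thesis by (rule that)
qed

text \<open>Continuity is what makes the maximal gap over the compact ball attained.\<close>

lemma gen_Lipschitz_continuous_on:
  assumes "gen_Lipschitz d f fstar M0 M1"
  shows "continuous_on (Rd d) f"
  unfolding continuous_on_iff
proof (intro ballI allI impI)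
  fix x and e :: real assume x: "x \<in> Rd d" and e: "e > 0"
  \<comment> \<open>The absolute value makes \<open>c\<close> positive, so that \<open>e / c\<close>
    is a valid radius; the added 1 makes it exceed the Lipschitz bound strictly.\<close>
  define c where "c = \<bar>M0 + M1 * (f x - fstar)\<bar> + 1"
  have c: "c > 0" "c > M0 + M1 * (f x - fstar)" unfolding c_def by linarith+
  obtain r where r: "r > 0"
    "\<And>u. u \<in> Rd d \<Longrightarrow> u \<noteq> 0 \<Longrightarrow> norm u < r \<Longrightarrow> \<bar>f (x + u) - f x\<bar> < c * norm u"
    using gen_Lipschitz_eventually[OF assms x c(2)] by blast
  have "dist (f y) (f x) < e" if y: "y \<in> Rd d" "dist y x < min r (e / c)" for y
  proof (cases "y = x")
    case False
    have "\<bar>f (x + (y - x)) - f x\<bar> < c * norm (y - x)"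
      using False y x by (intro r) (auto simp: dist_norm subspace_diff[OF subspace_Rd])
    also have "\<dots> < e" using y c by (simp add: dist_norm field_simps)
    finally show ?thesis by (simp add: dist_real_def)
  qed (use e in simp)
  then show "\<exists>r>0. \<forall>y\<in>Rd d. dist y x < r \<longrightarrow> dist (f y) (f x) < e"
    using r(1) c(1) e by (intro exI[of _ "min r (e / c)"]) auto
qed

text \<open>Moving along \<open>g\<close> itself, \<open>f\<close> grows at rate at least \<open>norm g\<close>.\<close>

lemma norm_subgradient_le:
  assumes "gen_Lipschitz d f fstar M0 M1" "x \<in> Rd d" "g \<in> subdifferential d f x"
    and "M0 + M1 * (f x - fstar) \<ge> 0"
  shows "norm g \<le> M0 + M1 * (f x - fstar)"
proof (rule ccontr)
  assume "\<not> ?thesis"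
  then have less: "norm g > M0 + M1 * (f x - fstar)" by simp
  with assms(4) have g0: "norm g > 0" by linarith
  \<comment> \<open>The slope to be contradicted, \<open>norm g\<close>, serves as \<open>c\<close>
    itself.\<close>
  obtain r where r: "r > 0"
    "\<And>u. u \<in> Rd d \<Longrightarrow> u \<noteq> 0 \<Longrightarrow> norm u < r \<Longrightarrow> \<bar>f (x + u) - f x\<bar> < norm g * norm u"
    using gen_Lipschitz_eventually[OF assms(1,2) less] by blast
  \<comment> \<open>This gives \<open>t *\<^sub>R g\<close> the norm \<open>r / 2\<close>.\<close>
  define t where "t = r / (2 * norm g)"
  have t: "t > 0" "t * norm g < r" using r(1) g0 by (auto simp: t_def)
  have g: "g \<in> Rd d" "\<And>y. y \<in> Rd d \<Longrightarrow> f x + inner g (y - x) \<le> f y"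
    using assms(3) by (auto simp: subdifferential_def)
  have tg: "t *\<^sub>R g \<in> Rd d" using g(1) by (simp add: subspace_Rd subspace_scale)
  have "f x + inner g (t *\<^sub>R g) \<le> f (x + t *\<^sub>R g)"
    using g(2)[OF subspace_add[OF subspace_Rd assms(2) tg]] by simp
  moreover have "inner g (t *\<^sub>R g) = norm g * norm (t *\<^sub>R g)"
    using t(1) by (simp add: power2_norm_eq_inner[symmetric] power2_eq_square[of "norm g"])
  moreover have "\<bar>f (x + t *\<^sub>R g) - f x\<bar> < norm g * norm (t *\<^sub>R g)"
    using tg t g0 by (intro r) auto
  ultimately show False by linarith
qed

text \<open>\<open>GREATEST\<close> is informative only if the maximum is attained, which holds on
  the compact ball.\<close>

lemma gap_le_max_gap:
  assumes "continuous_on (Rd d) f" "x \<in> Q d R"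
  shows "f x - c \<le> max_gap d f c R"
proof -
  have "continuous_on (Q d R) f" using assms(1) Q_subset_Rd by (rule continuous_on_subset)
  then obtain z where z: "z \<in> Q d R" "\<And>y. y \<in> Q d R \<Longrightarrow> f y \<le> f z"
    using continuous_attains_sup[OF compact_Q] assms(2) by blast
  have "max_gap d f c R = f z - c"
    unfolding max_gap_def using z by (intro Greatest_equality) auto
  then show ?thesis using z(2)[OF assms(2)] by simp
qed

section \<open>The projected subgradient method\<close>

lemma projected_subgradient_step:
  assumes f: "gen_Lipschitz d f (f xstar) M0 M1" "M0 \<ge> 0" "M1 \<ge> 0"
    and xstar: "xstar \<in> Q d R" "f xstar \<le> f x"
    and x: "x \<in> Q d R" and g: "g \<in> subdifferential d f x"
    and F: "f x - f xstar \<le> F" and h: "h > 0" "2 * M1\<^sup>2 * F * h \<le> 1"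
  shows "h * (f x - f xstar) \<le> (norm (x - xstar))\<^sup>2
    - (norm (proj (Q d R) (x - h *\<^sub>R g) - xstar))\<^sup>2 + 2 * h\<^sup>2 * M0\<^sup>2"
proof -
  define \<delta> where "\<delta> = f x - f xstar"
  have \<delta>: "0 \<le> \<delta>" "\<delta> \<le> F" using xstar(2) F by (auto simp: \<delta>_def)
  have Rd: "x \<in> Rd d" "xstar \<in> Rd d" using x xstar(1) Q_subset_Rd by auto
  have "norm g \<le> M0 + M1 * \<delta>"
    using norm_subgradient_le[OF f(1) Rd(1) g] f(2,3) \<delta>(1) by (simp add: \<delta>_def)
  then have "(norm g)\<^sup>2 \<le> (M0 + M1 * \<delta>)\<^sup>2" by (rule power_mono) simp
  also have "\<dots> \<le> 2 * M0\<^sup>2 + 2 * M1\<^sup>2 * \<delta>\<^sup>2"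
    using zero_le_power2[of "M0 - M1 * \<delta>"] by (simp add: power2_eq_square algebra_simps)
  \<comment> \<open>Trading one factor \<open>\<delta>\<close> for \<open>F\<close> makes the bound
    linear in \<open>\<delta>\<close>, hence comparable with the decrease.\<close>
  also have "2 * M1\<^sup>2 * \<delta>\<^sup>2 \<le> 2 * M1\<^sup>2 * (F * \<delta>)"
    using \<delta> unfolding power2_eq_square[of \<delta>] by (intro mult_left_mono mult_right_mono) auto
  finally have "h\<^sup>2 * (norm g)\<^sup>2 \<le> h\<^sup>2 * (2 * M0\<^sup>2 + 2 * M1\<^sup>2 * (F * \<delta>))"
    by (intro mult_left_mono) auto
  also have "\<dots> = 2 * h\<^sup>2 * M0\<^sup>2 + (2 * M1\<^sup>2 * F * h) * (h * \<delta>)"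
    by (simp add: power2_eq_square algebra_simps)
  also have "(2 * M1\<^sup>2 * F * h) * (h * \<delta>) \<le> 1 * (h * \<delta>)"
    using h \<delta>(1) by (intro mult_right_mono) auto
  finally have gbound: "h\<^sup>2 * (norm g)\<^sup>2 \<le> 2 * h\<^sup>2 * M0\<^sup>2 + h * \<delta>" by simp
  have "f x + inner g (xstar - x) \<le> f xstar"
    using g Rd(2) by (auto simp: subdifferential_def)
  then have "h * \<delta> \<le> h * inner g (x - xstar)"
    using h(1) by (intro mult_left_mono) (auto simp: \<delta>_def inner_diff_right)
  moreover have "(norm (proj (Q d R) (x - h *\<^sub>R g) - xstar))\<^sup>2 \<le> (norm (x - h *\<^sub>R g - xstar))\<^sup>2"
    by (intro power_mono norm_proj_diff_le compact_Q convex_Q xstar) simp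
  moreover have "(norm (x - h *\<^sub>R g - xstar))\<^sup>2
      = (norm (x - xstar))\<^sup>2 - 2 * (h * inner g (x - xstar)) + h\<^sup>2 * (norm g)\<^sup>2"
    unfolding power2_norm_eq_inner
    by (simp add: algebra_simps inner_commute power2_eq_square)
  \<comment> \<open>The expansion supplies two copies of \<open>h * \<delta>\<close>;
    \<open>gbound\<close> consumes one.\<close>
  ultimately show ?thesis using gbound unfolding \<delta>_def by linarith
qed

lemma projected_subgradient_average:
  assumes f: "convex_on (Rd d) f" "gen_Lipschitz d f (f xstar) M0 M1" "M0 \<ge> 0" "M1 \<ge> 0"
    and xstar: "xstar \<in> Q d R" "\<And>y. y \<in> Rd d \<Longrightarrow> f xstar \<le> f y"
    and F: "F = max_gap d f (f xstar) R" and h: "h > 0" "2 * M1\<^sup>2 * F * h \<le> 1"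
    and x0: "x 0 = 0"
    and step: "\<And>k. g k \<in> subdifferential d f (x k)"
      "\<And>k. x (Suc k) = proj (Q d R) (x k - h *\<^sub>R g k)"
  shows "f ((1 / real (K + 1)) *\<^sub>R (\<Sum>k=0..K. x k)) - f xstar
    \<le> R\<^sup>2 / (h * real (K + 1)) + 2 * h * M0\<^sup>2"
proof -
  have R: "norm xstar \<le> R" "R \<ge> 0"
    using xstar(1) by (auto simp: Q_def intro: order_trans[OF norm_ge_zero])
  have xQ: "x k \<in> Q d R" for k
  proof (cases k)
    case 0
    then show ?thesis using R x0 by (simp add: Q_def Rd_def)
  next
    case (Suc j)
    \<comment> \<open>\<open>xstar\<close> witnesses that the ball is nonempty, as
      \<open>proj_in\<close> requires.\<close>
    then show ?thesis using xstar(1) by (auto simp: step(2) intro!: proj_in compact_Q)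
  qed
  have xRd: "x k \<in> Rd d" for k using xQ Q_subset_Rd by blast
  define \<delta> where "\<delta> k = f (x k) - f xstar" for k
  define D where "D k = (norm (x k - xstar))\<^sup>2" for k
  have one: "h * \<delta> k \<le> D k - D (Suc k) + 2 * h\<^sup>2 * M0\<^sup>2" for k
    unfolding \<delta>_def D_def step(2) using F
    by (intro projected_subgradient_step[OF f(2-4) xstar(1,2) xQ step(1) _ h] xRd)
      (auto intro: gap_le_max_gap[OF gen_Lipschitz_continuous_on[OF f(2)] xQ])
  have "h * (\<Sum>k=0..K. \<delta> k) \<le> (\<Sum>k=0..K. D k - D (Suc k) + 2 * h\<^sup>2 * M0\<^sup>2)"
    unfolding sum_distrib_left by (intro sum_mono one)
  also have "\<dots> = D 0 - D (Suc K) + real (K + 1) * (2 * h\<^sup>2 * M0\<^sup>2)"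
    unfolding sum.distrib using sum_telescope[of D K] by (simp add: atLeast0AtMost)
  also have "\<dots> \<le> R\<^sup>2 + real (K + 1) * (2 * h\<^sup>2 * M0\<^sup>2)"
  proof -
    \<comment> \<open>Starting at 0 makes \<open>D 0\<close> the squared norm of
      \<open>xstar\<close>.\<close>
    have "D 0 \<le> R\<^sup>2" "0 \<le> D (Suc K)"
      using power_mono[OF R(1) norm_ge_zero, of 2] by (simp_all add: D_def x0)
    then show ?thesis by linarith
  qed
  finally have "h * (\<Sum>k=0..K. \<delta> k) / (h * real (K + 1))
      \<le> (R\<^sup>2 + real (K + 1) * (2 * h\<^sup>2 * M0\<^sup>2)) / (h * real (K + 1))"
    using h(1) by (intro divide_right_mono) auto
  also have "\<dots> = R\<^sup>2 / (h * real (K + 1)) + 2 * h * M0\<^sup>2"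
    using h(1) by (simp add: add_divide_distrib power2_eq_square del: of_nat_add of_nat_Suc)
  finally have "(\<Sum>k=0..K. \<delta> k) / real (K + 1) \<le> R\<^sup>2 / (h * real (K + 1)) + 2 * h * M0\<^sup>2"
    using h(1) by simp
  \<comment> \<open>Jensen's inequality with \<open>K + 1\<close> equal weights.\<close>
  moreover have "f (\<Sum>k=0..K. (1 / real (K + 1)) *\<^sub>R x k) \<le> (\<Sum>k=0..K. 1 / real (K + 1) * f (x k))"
    by (intro convex_on_sum[OF _ _ f(1)] xRd) auto
  moreover have "(\<Sum>k=0..K. 1 / real (K + 1) * f (x k)) = (\<Sum>k=0..K. \<delta> k) / real (K + 1) + f xstar"
    by (simp add: \<delta>_def sum_subtractf sum_divide_distrib[symmetric] diff_divide_distrib)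
  ultimately show ?thesis by (simp add: scaleR_sum_right)
qed

text \<open>Used with \<open>N = K + 1\<close>. The two summands bounded by \<open>N\<close> match
  the two entries of the maximum: each makes the corresponding value of \<open>1 / h\<close>
  harmless.\<close>

lemma stepsize_error_le:
  fixes R M0 M1 F \<epsilon> h N :: real
  assumes pos: "R > 0" "M0 \<ge> 0" "F \<ge> 0" "\<epsilon> > 0" "h > 0" "N > 0"
    and h: "1 / h = max (2 * M1\<^sup>2 * F) (M0 * sqrt N / R)"
    and N: "(R * M1)\<^sup>2 * (F / \<epsilon>) + (R * M0 / \<epsilon>)\<^sup>2 \<le> N"
  shows "R\<^sup>2 / (h * N) + 2 * h * M0\<^sup>2 \<le> 5 * \<epsilon>"
proof -
  have "(R * M1)\<^sup>2 * (F / \<epsilon>) \<le> N" using N zero_le_power2[of "R * M0 / \<epsilon>"] by linarith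
  then have 1: "R\<^sup>2 * (2 * M1\<^sup>2 * F) / N \<le> 2 * \<epsilon>"
    using pos by (simp add: field_simps)
  \<comment> \<open>Dropping the other summand relies on \<open>F \<ge> 0\<close>.\<close>
  have "(R * M0 / \<epsilon>)\<^sup>2 \<le> N" using N pos
    by (intro order_trans[OF _ N]) simp
  then have "R * M0 / \<epsilon> \<le> sqrt N" by (rule real_le_rsqrt)
  then have 2: "R * M0 / sqrt N \<le> \<epsilon>" using pos by (simp add: field_simps)
  have sq: "sqrt N * sqrt N = N" using pos by simp
  have 3: "R\<^sup>2 * (M0 * sqrt N / R) / N \<le> \<epsilon>"
  proof -
    have "R\<^sup>2 * (M0 * sqrt N / R) / N = R * M0 / sqrt N"
      using pos sq by (simp add: field_simps power2_eq_square)
    with 2 show ?thesis by simp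
  qed
  have "R\<^sup>2 / (h * N) = R\<^sup>2 * (1 / h) / N" by simp
  also have "\<dots> \<le> 2 * \<epsilon>" using 1 3 pos(4) unfolding h by (cases "2 * M1\<^sup>2 * F \<le> M0 * sqrt N / R") (auto simp: max_def)
  finally have A: "R\<^sup>2 / (h * N) \<le> 2 * \<epsilon>" .
  \<comment> \<open>The second error term needs \<open>h\<close> small, so only this entry of the
    maximum matters for it.\<close>
  have "M0 * sqrt N / R \<le> 1 / h" unfolding h by simp
  then have "h * M0 \<le> R / sqrt N" using pos by (simp add: field_simps)
  then have "h * M0 * M0 \<le> R / sqrt N * M0" using pos(2) by (rule mult_right_mono)
  with 2 have "2 * h * M0\<^sup>2 \<le> 2 * \<epsilon>" by (simp add: power2_eq_square algebra_simps)
  \<comment> \<open>The two bounds add up to \<open>4 * \<epsilon>\<close>; the constant 5 leaves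
    slack.\<close>
  with A pos(4) show ?thesis by linarith
qed

theorem theorem1:
  shows "\<exists>C>0. \<forall>(d::nat) (f :: fseq \<Rightarrow> real) (xstar :: fseq) (fstar::real) (R::real) (M0::real) (M1::real)
      (F::real) (\<epsilon>::real) (K::nat) (\<eta> :: nat \<Rightarrow> real) (g :: nat \<Rightarrow> fseq) (x :: nat \<Rightarrow> fseq).
    d \<ge> 1 \<longrightarrow>
    convex_on (Rd d) f \<longrightarrow>
    xstar \<in> Rd d \<longrightarrow> (\<forall>y\<in>Rd d. f xstar \<le> f y) \<longrightarrow> fstar = f xstar \<longrightarrow>
    R > 0 \<longrightarrow> norm xstar \<le> R \<longrightarrow>
    M0 \<ge> 0 \<longrightarrow> M1 \<ge> 0 \<longrightarrow> gen_Lipschitz d f fstar M0 M1 \<longrightarrow>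
    F = max_gap d f fstar R \<longrightarrow>
    \<epsilon> > 0 \<longrightarrow>
    K \<ge> 1 \<longrightarrow> int K = \<lceil>(R * M1)\<^sup>2 * (F / \<epsilon>) + (R * M0 / \<epsilon>)\<^sup>2\<rceil> \<longrightarrow>
    (\<forall>k. \<eta> k > 0 \<and> 1 / \<eta> k = max (2 * M1\<^sup>2 * F) (M0 * sqrt (real (K + 1)) / R)) \<longrightarrow>
    x 0 = 0 \<longrightarrow>
    (\<forall>k. g k \<in> subdifferential d f (x k) \<and> x (k + 1) = proj (Q d R) (x k - \<eta> k *\<^sub>R g k)) \<longrightarrow>
    f ((1 / real (K + 1)) *\<^sub>R (\<Sum>k=0..K. x k)) - fstar \<le> C * \<epsilon>"
proof (rule exI[of _ 5], intro conjI allI impI)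
  fix d :: nat and f :: "fseq \<Rightarrow> real" and xstar :: fseq and fstar R M0 M1 F \<epsilon> :: real
    and K :: nat and \<eta> :: "nat \<Rightarrow> real" and g x :: "nat \<Rightarrow> fseq"
  assume f: "convex_on (Rd d) f" and xstar: "xstar \<in> Rd d" "\<forall>y\<in>Rd d. f xstar \<le> f y"
    and fstar: "fstar = f xstar" and R: "R > 0" "norm xstar \<le> R"
    and M: "M0 \<ge> 0" "M1 \<ge> 0" "gen_Lipschitz d f fstar M0 M1"
    and F: "F = max_gap d f fstar R" and \<epsilon>: "\<epsilon> > 0"
    and K: "int K = \<lceil>(R * M1)\<^sup>2 * (F / \<epsilon>) + (R * M0 / \<epsilon>)\<^sup>2\<rceil>"
    and \<eta>: "\<forall>k. \<eta> k > 0 \<and> 1 / \<eta> k = max (2 * M1\<^sup>2 * F) (M0 * sqrt (real (K + 1)) / R)"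
    and x0: "x 0 = 0"
    and step: "\<forall>k. g k \<in> subdifferential d f (x k) \<and> x (k + 1) = proj (Q d R) (x k - \<eta> k *\<^sub>R g k)"
  define h where "h = \<eta> 0"
  \<comment> \<open>The prescribed \<open>1 / \<eta> k\<close> does not involve \<open>k\<close>, so
    the stepsize is constant.\<close>
  have \<eta>_h: "\<eta> k = h" for k
  proof -
    have "1 / \<eta> k = 1 / h" using \<eta> by (simp add: h_def)
    then show ?thesis by simp
  qed
  have h: "h > 0" "1 / h = max (2 * M1\<^sup>2 * F) (M0 * sqrt (real (K + 1)) / R)"
    using \<eta> by (auto simp: h_def)
  have xstarQ: "xstar \<in> Q d R" using xstar(1) R(2) by (simp add: Q_def)
  \<comment> \<open>The gap at \<open>xstar\<close> is 0 and cannot exceed the maximal one.\<close>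
  have F0: "F \<ge> 0"
    using gap_le_max_gap[OF gen_Lipschitz_continuous_on[OF M(3)] xstarQ, of fstar]
    by (simp add: F fstar)
  have "2 * M1\<^sup>2 * F \<le> 1 / h" unfolding h(2) by simp
  then have "2 * M1\<^sup>2 * F * h \<le> 1" using h(1) by (simp add: field_simps)
  then have "f ((1 / real (K + 1)) *\<^sub>R (\<Sum>k=0..K. x k)) - f xstar
      \<le> R\<^sup>2 / (h * real (K + 1)) + 2 * h * M0\<^sup>2"
    using f M F xstar(2) xstarQ h(1) x0 step
    by (intro projected_subgradient_average[where d = d and f = f and F = F and ?M1.0 = M1 and g = g])
      (auto simp: fstar \<eta>_h)
  \<comment> \<open>A ceiling dominates its argument, so already \<open>K\<close> would be large
    enough.\<close>
  also have "(R * M1)\<^sup>2 * (F / \<epsilon>) + (R * M0 / \<epsilon>)\<^sup>2 \<le> real (K + 1)"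
    using K by linarith
  then have "R\<^sup>2 / (h * real (K + 1)) + 2 * h * M0\<^sup>2 \<le> 5 * \<epsilon>"
    using R(1) M(1) F0 \<epsilon> h by (intro stepsize_error_le) auto
  finally show "f ((1 / real (K + 1)) *\<^sub>R (\<Sum>k=0..K. x k)) - fstar \<le> 5 * \<epsilon>"
    by (simp add: fstar)
qed simp

end
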